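(* For every positive integer $n$, the set $B_n(132,213)$ is in bijection with the set of left factors of Dyck paths with $n-1$ steps. Consequently, for every $n\ge 0$, $|B_{n+1}(132,213)|=\binom{n}{\lfloor n/2\rfloor}$.
   Context: A permutation $\sigma\in S_n$ is written as $\sigma(1)\cdots\sigma(n)$. An index $i\in[n-1]$ is an ascent if $\sigma(i)<\sigma(i+1)$ and a descent if $\sigma(i)>\sigma(i+1)$. A ballot permutation is a permutation such that every prefix $\sigma(1)\cdots\sigma(p)$ has at least as many ascents as descents. $\sigma$ contains a pattern $\pi\in S_k$ if some subsequence $\sigma(c_1)\cdots\sigma(c_k)$ with $c_1<\dots<c_k$ is order-isomorphic to $\pi$, and avoids $\pi$ otherwise. $B_n(\pi_1,\dots,\pi_m)$ denotes the set of ballot permutations of length $n$ avoiding all of $\pi_1,\dots,\pi_m$. A left factor of a Dyck path with $m$ steps is a word of length $m$ in the letters $U$ (up step) and $D$ (down step) such that every prefix contains at least as many $U$'s as $D$'s (equivalently, a length-$m$ prefix of some Dyck path). *)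

theory Defs
  imports "HOL-Combinatorics.Multiset_Permutations" "HOL-Library.Sublist"
begin

text \<open>
  A permutation \<open>\<sigma>\<close> of length \<open>n\<close> is its one-line notation \<open>\<sigma>(1) \<dots> \<sigma>(n)\<close>, that is, an element of
  \<^term>\<open>permutations_of_set {1..n}\<close>. List positions start at \<open>0\<close>, so \<open>\<sigma>(i)\<close> is \<open>\<sigma> ! (i - 1)\<close>.
\<close>

definition ascents :: "nat list \<Rightarrow> nat set" where
  "ascents \<sigma> = {i \<in> {1..<length \<sigma>}. \<sigma> ! (i - 1) < \<sigma> ! i}"

definition descents :: "nat list \<Rightarrow> nat set" where
  "descents \<sigma> = {i \<in> {1..<length \<sigma>}. \<sigma> ! (i - 1) > \<sigma> ! i}"

definition ballot :: "nat list \<Rightarrow> bool" where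
  "ballot \<sigma> \<longleftrightarrow> (\<forall>\<tau>. prefix \<tau> \<sigma> \<longrightarrow> card (descents \<tau>) \<le> card (ascents \<tau>))"

definition order_isomorphic :: "nat list \<Rightarrow> nat list \<Rightarrow> bool" where
  "order_isomorphic \<tau> \<pi> \<longleftrightarrow> length \<tau> = length \<pi> \<and>
     (\<forall>i<length \<pi>. \<forall>j<length \<pi>. \<tau> ! i < \<tau> ! j \<longleftrightarrow> \<pi> ! i < \<pi> ! j)"

definition contains_pattern :: "nat list \<Rightarrow> nat list \<Rightarrow> bool" where
  "contains_pattern \<sigma> \<pi> \<longleftrightarrow> (\<exists>\<tau>. subseq \<tau> \<sigma> \<and> order_isomorphic \<tau> \<pi>)"

definition ballot_avoiders :: "nat \<Rightarrow> nat list set \<Rightarrow> nat list set" where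
  "ballot_avoiders n P =
     {\<sigma> \<in> permutations_of_set {1..n}. ballot \<sigma> \<and> (\<forall>\<pi>\<in>P. \<not> contains_pattern \<sigma> \<pi>)}"

datatype step = Up | Down

definition dyck_left_factors :: "nat \<Rightarrow> step list set" where
  "dyck_left_factors m =
     {w. length w = m \<and> (\<forall>v. prefix v w \<longrightarrow> count_list v Down \<le> count_list v Up)}"

end

theory Submission
  imports Defs
begin

text \<open>
  A permutation avoiding 132 and 213 is determined by its word of ascents and descents, and every
  word occurs: if the word starts with exactly \<open>k\<close> ascents, then the first entry has exactly \<open>k\<close>
  larger entries, since after an initial descent nothing may exceed the first entry (213), and
  after an initial ascent nothing may lie strictly between the first two entries (132). Under this
  bijection the ballot permutations correspond to the left factors of Dyck paths.

  For the count, consider more generally the words of length \<open>m\<close> that stay nonnegative when started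
  at height \<open>k - 1\<close>. By the reflection principle their number is the sum of the \<open>m choose d\<close>
  over all \<open>d\<close> with \<open>m - k \<le> 2 * d < m + k\<close>, which is verified by induction on \<open>m\<close>.
\<close>

section \<open>Ascent-descent words\<close>

text \<open>A tie is recorded as \<open>Down\<close>. Hence the count of \<open>Up\<close> equals
  the number of ascents for every list, while the count of \<open>Down\<close> equals the number of
  descents only under distinctness.\<close>

fun signature :: "nat list \<Rightarrow> step list" where
  "signature (x # y # xs) = (if x < y then Up else Down) # signature (y # xs)"
| "signature _ = []"

lemma length_signature: "length (signature xs) = length xs - 1"
  by (induction xs rule: signature.induct) auto

lemma signature_take: "signature (take (Suc p) xs) = take p (signature xs)"
proof (induction xs arbitrary: p rule: signature.induct)
  case (1 x y xs)
  then show ?case by (cases p) auto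
qed auto

lemma ascents_Cons_Cons:
  "ascents (x # y # xs) = (if x < y then {1} else {}) \<union> Suc ` ascents (y # xs)"
proof (rule set_eqI)
  fix i
  show "i \<in> ascents (x # y # xs) \<longleftrightarrow>
      i \<in> (if x < y then {1} else {}) \<union> Suc ` ascents (y # xs)"
  proof (cases i)
    case (Suc j)
    then show ?thesis by (cases j) (auto simp: ascents_def image_iff)
  qed (auto simp: ascents_def)
qed

lemma descents_Cons_Cons:
  "descents (x # y # xs) = (if y < x then {1} else {}) \<union> Suc ` descents (y # xs)"
proof (rule set_eqI)
  fix i
  show "i \<in> descents (x # y # xs) \<longleftrightarrow>
      i \<in> (if y < x then {1} else {}) \<union> Suc ` descents (y # xs)"
  proof (cases i)
    case (Suc j)
    then show ?thesis by (cases j) (auto simp: descents_def image_iff)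
  qed (auto simp: descents_def)
qed

lemma card_ascents: "card (ascents xs) = count_list (signature xs) Up"
proof (induction xs rule: signature.induct)
  case (1 x y xs)
  \<comment> \<open>Since 0 is not an ascent, 1 is not in the image under \<open>Suc\<close>, so an
    initial ascent adds a new element.\<close>
  have "finite (ascents (y # xs))" "0 \<notin> ascents (y # xs)"
    by (auto simp: ascents_def)
  with 1 show ?case
    by (auto simp: ascents_Cons_Cons card_image card_insert_if)
qed (auto simp: ascents_def)

lemma card_descents:
  assumes "distinct xs"
  shows "card (descents xs) = count_list (signature xs) Down"
  using assms
proof (induction xs rule: signature.induct)
  case (1 x y xs)
  have "finite (descents (y # xs))" "0 \<notin> descents (y # xs)"
    by (auto simp: descents_def)
  with 1 show ?case
    by (auto simp: descents_Cons_Cons card_image card_insert_if)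
qed (auto simp: descents_def)

lemma all_nat_split: "(\<forall>p. P p) \<longleftrightarrow> P 0 \<and> (\<forall>p. P (Suc p))" for P :: "nat \<Rightarrow> bool"
  by (metis not0_implies_Suc)

lemma all_prefix_iff_take: "(\<forall>v. prefix v xs \<longrightarrow> P v) \<longleftrightarrow> (\<forall>p. P (take p xs))"
proof (intro iffI allI impI)
  fix v assume "\<forall>p. P (take p xs)" "prefix v xs"
  moreover have "v = take (length v) xs"
    using \<open>prefix v xs\<close> by (auto simp: prefix_def)
  ultimately show "P v" by metis
qed (simp add: take_is_prefix)

lemma ballot_iff_signature:
  assumes "distinct xs"
  shows "ballot xs \<longleftrightarrow>
    (\<forall>v. prefix v (signature xs) \<longrightarrow> count_list v Down \<le> count_list v Up)"
proof -
  have "ballot xs \<longleftrightarrow> (\<forall>p. card (descents (take p xs)) \<le> card (ascents (take p xs)))"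
    unfolding ballot_def by (rule all_prefix_iff_take)
  also have "\<dots> \<longleftrightarrow> (\<forall>p. count_list (signature (take p xs)) Down \<le>
      count_list (signature (take p xs)) Up)"
    using assms by (simp add: card_ascents card_descents)
  \<comment> \<open>A prefix with \<open>Suc p\<close> entries has \<open>p\<close> steps. The empty
    prefix, also without steps, is split off first.\<close>
  also have "\<dots> \<longleftrightarrow> (\<forall>p. count_list (take p (signature xs)) Down \<le>
      count_list (take p (signature xs)) Up)"
    by (subst (1) all_nat_split) (simp add: signature_take)
  also have "\<dots> \<longleftrightarrow>
      (\<forall>v. prefix v (signature xs) \<longrightarrow> count_list v Down \<le> count_list v Up)"
    by (rule all_prefix_iff_take[symmetric])
  finally show ?thesis .
qed

section \<open>Lists avoiding 132 and 213\<close>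

definition avoids_132_213 :: "nat list \<Rightarrow> bool" where
  "avoids_132_213 xs \<longleftrightarrow>
     (\<forall>a b c. subseq [a, b, c] xs \<longrightarrow> \<not> (a < c \<and> c < b) \<and> \<not> (b < a \<and> a < c))"

lemma order_isomorphic_132:
  "order_isomorphic t [1, 3, 2] \<longleftrightarrow> (\<exists>a b c. t = [a, b, c] \<and> a < c \<and> c < b)"
  by (auto simp: order_isomorphic_def length_Suc_conv All_less_Suc2 numeral_eq_Suc)

lemma order_isomorphic_213:
  "order_isomorphic t [2, 1, 3] \<longleftrightarrow> (\<exists>a b c. t = [a, b, c] \<and> b < a \<and> a < c)"
  by (auto simp: order_isomorphic_def length_Suc_conv All_less_Suc2 numeral_eq_Suc)

lemma avoids_132_213_iff:
  "avoids_132_213 xs \<longleftrightarrow> (\<forall>\<pi>\<in>{[1, 3, 2], [2, 1, 3]}. \<not> contains_pattern xs \<pi>)"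
  unfolding avoids_132_213_def contains_pattern_def
  by (simp only: ball_simps order_isomorphic_132 order_isomorphic_213) blast

text \<open>A new occurrence of either pattern must use \<open>x\<close> as its first letter, which
  leaves a condition on pairs in the tail.\<close>

lemma avoids_132_213_Cons:
  "avoids_132_213 (x # xs) \<longleftrightarrow> avoids_132_213 xs \<and>
     (\<forall>b c. subseq [b, c] xs \<longrightarrow> \<not> (x < c \<and> c < b) \<and> \<not> (b < x \<and> x < c))"
proof -
  have "subseq [a, b, c] (x # xs) \<longleftrightarrow> a = x \<and> subseq [b, c] xs \<or> subseq [a, b, c] xs" for a b c
    using subseq_Cons'[of a "[b, c]" xs] by auto
  then show ?thesis
    unfolding avoids_132_213_def by (simp only:) (rule iffI; blast)
qed

section \<open>Rank of the first entry, and injectivity\<close>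

abbreviation up_run :: "step list \<Rightarrow> nat" where
  "up_run w \<equiv> length (takeWhile ((=) Up) w)"

lemma card_greater_hd:
  assumes "distinct xs" "avoids_132_213 xs" "xs \<noteq> []"
  shows "card {z \<in> set xs. hd xs < z} = up_run (signature xs)"
  using assms
proof (induction xs rule: signature.induct)
  case (1 x y xs)
  \<comment> \<open>Only the pairs whose first member is the second entry \<open>y\<close> are
    needed.\<close>
  have av: "\<not> (x < z \<and> z < y) \<and> \<not> (y < x \<and> x < z)" if "z \<in> set xs" for z
  proof -
    have "subseq [y, z] (y # xs)" using that by (simp add: subseq_singleton_left)
    then show ?thesis using 1(3) unfolding avoids_132_213_Cons[of x] by blast
  qed
  have IH: "card {z \<in> set (y # xs). y < z} = up_run (signature (y # xs))"
    using 1 by (simp add: avoids_132_213_Cons[of x])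
  show ?case
  proof (cases "x < y")
    case True
    have "{z \<in> set (x # y # xs). x < z} = insert y {z \<in> set (y # xs). y < z}"
      using av True 1(2) by force
    then show ?thesis using IH True by simp
  next
    case False
    then have "{z \<in> set (x # y # xs). x < z} = {}"
      using av 1(2) by force
    then show ?thesis using False by (simp del: set_simps)
  qed
qed auto

text \<open>For \<open>a < b\<close> in \<open>S\<close>, the elements above \<open>b\<close> form a
  proper subset of those above \<open>a\<close>, because \<open>b\<close> itself is lost.\<close>

lemma card_greater_inj:
  fixes x y :: "'a::linorder"
  assumes "finite S" "x \<in> S" "y \<in> S" "card {z \<in> S. x < z} = card {z \<in> S. y < z}"
  shows "x = y"
proof -
  have "card {z \<in> S. b < z} < card {z \<in> S. a < z}" if "a < b" "b \<in> S" for a b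
  proof (rule psubset_card_mono)
    have "{z \<in> S. b < z} \<subseteq> {z \<in> S. a < z}" using that by auto
    then show "{z \<in> S. b < z} \<subset> {z \<in> S. a < z}" using that by blast
  qed (simp add: assms(1))
  from this[of x y] this[of y x] assms show ?thesis
    by (cases x y rule: linorder_cases) simp_all
qed

text \<open>The ranks are pairwise distinct and below \<open>card S\<close>, so by counting they
  fill \<open>{..<card S}\<close>.\<close>

lemma ex_card_greater:
  fixes S :: "'a::linorder set"
  assumes "finite S" "k < card S"
  shows "\<exists>x\<in>S. card {z \<in> S. x < z} = k"
proof -
  let ?f = "\<lambda>x. card {z \<in> S. x < z}"
  have "inj_on ?f S"
    using card_greater_inj[OF assms(1)] by (auto intro: inj_onI)
  moreover have "?f x < card S" if "x \<in> S" for x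
    using assms(1) that by (intro psubset_card_mono) blast+
  ultimately have "?f ` S = {..<card S}"
    by (intro card_subset_eq) (auto simp: card_image)
  with assms(2) have "k \<in> ?f ` S" by simp
  then show ?thesis by blast
qed

text \<open>The initial run of \<open>Up\<close> fixes the rank of the first entry in the common set
  of values. The heads therefore agree, and removing them leaves the same problem for the
  tails.\<close>

lemma signature_inj:
  assumes "distinct xs" "distinct ys" "avoids_132_213 xs" "avoids_132_213 ys"
    "set xs = set ys" "signature xs = signature ys"
  shows "xs = ys"
  using assms
proof (induction xs arbitrary: ys)
  case (Cons x xs)
  then obtain y ys' where ys: "ys = y # ys'" by (cases ys) auto
  have "x = y"
  proof (rule card_greater_inj[of "set ys"])
    have "card {z \<in> set (x # xs). x < z} = up_run (signature (x # xs))"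
      using card_greater_hd[OF Cons.prems(1,3)] by (simp del: set_simps)
    moreover have "card {z \<in> set ys. y < z} = up_run (signature ys)"
      using card_greater_hd[OF Cons.prems(2,4)] by (simp add: ys del: set_simps)
    ultimately show "card {z \<in> set ys. x < z} = card {z \<in> set ys. y < z}"
      unfolding Cons.prems(5,6) by simp
  qed (use Cons.prems(5) ys in auto)
  moreover have "signature xs = signature ys'"
    using Cons.prems(6) ys by (cases xs; cases ys') auto
  moreover have "set xs = set ys'"
    using Cons.prems \<open>x = y\<close> by (auto simp: ys)
  ultimately show ?case
    using Cons.IH[of ys'] Cons.prems by (simp add: ys avoids_132_213_Cons)
qed simp

section \<open>Building a list with a given word\<close>

lemma subseq_two_imp_in_set: "subseq [b, c] xs \<Longrightarrow> c \<in> set xs"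
  using subseq_Cons'[of b "[c]" xs] by (simp only: subseq_singleton_left)

text \<open>In both patterns the last letter exceeds the first, so a greatest entry cannot be the
  first letter.\<close>

lemma avoids_132_213_Cons_greatest:
  assumes "avoids_132_213 xs" "\<And>z. z \<in> set xs \<Longrightarrow> z < x"
  shows "avoids_132_213 (x # xs)"
  unfolding avoids_132_213_Cons
proof (intro conjI allI impI assms(1))
  fix b c assume "subseq [b, c] xs"
  then have "c < x" by (intro assms(2) subseq_two_imp_in_set)
  then show "\<not> (x < c \<and> c < b)" "\<not> (b < x \<and> x < c)" by auto
qed

text \<open>No entry lies strictly between \<open>x\<close> and \<open>y\<close>, so a pattern
  starting with \<open>x\<close> would remain one with \<open>y\<close> in place of
  \<open>x\<close>.\<close>

lemma avoids_132_213_Cons_predecessor: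
  assumes "avoids_132_213 (y # ys)" "x < y"
    and gap: "\<And>z. z \<in> set ys \<Longrightarrow> x < z \<Longrightarrow> y < z"
  shows "avoids_132_213 (x # y # ys)"
  unfolding avoids_132_213_Cons[of x]
proof (intro conjI allI impI assms(1))
  fix b c assume sub: "subseq [b, c] (y # ys)"
  have c: "c \<in> set ys"
    using sub by (auto simp: subseq_singleton_left dest: subseq_two_imp_in_set split: if_splits)
  have y: "\<not> (y < c \<and> c < b) \<and> \<not> (b < y \<and> y < c)"
    using assms(1) sub c \<open>x < y\<close>
    by (auto simp: avoids_132_213_Cons[of y] split: if_splits)
  with gap[OF c] \<open>x < y\<close> show "\<not> (x < c \<and> c < b)" "\<not> (b < x \<and> x < c)"
    by auto
qed

text \<open>The first entry \<open>x\<close> is chosen with the rank forced by the word, and the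
  induction hypothesis arranges the other values. It remains to see that prepending \<open>x\<close>
  produces the step \<open>s\<close> and no pattern.\<close>

lemma signature_surj:
  assumes "finite S" "card S = Suc (length w)"
  shows "\<exists>xs. set xs = S \<and> distinct xs \<and> avoids_132_213 xs \<and> signature xs = w"
  using assms
proof (induction w arbitrary: S)
  case Nil
  then obtain x where "S = {x}" by (auto simp: card_Suc_eq)
  then show ?case
    by (intro exI[of _ "[x]"]) (auto simp: avoids_132_213_Cons avoids_132_213_def)
next
  case (Cons s w)
  have "up_run (s # w) < card S"
    using Cons.prems by (simp add: length_takeWhile_le le_imp_less_Suc)
  then obtain x where x: "x \<in> S" "card {z \<in> S. x < z} = up_run (s # w)"
    using ex_card_greater[OF Cons.prems(1)] by blast
  obtain ys where ys: "set ys = S - {x}" "distinct ys" "avoids_132_213 ys" "signature ys = w"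
    using Cons.IH[of "S - {x}"] Cons.prems x(1) by auto
  have "ys \<noteq> []" using ys(1) Cons.prems x(1)
    by (metis card_Diff_singleton diff_Suc_1 list.set(1) card.empty length_Cons nat.distinct(1))
  then obtain y ys' where y: "ys = y # ys'" by (cases ys) auto
  have yS: "y \<in> S" "y \<noteq> x" using ys(1) y by auto
  have S: "S = set (x # ys)" using ys(1) x(1) by auto
  have cy: "card {z \<in> S - {x}. y < z} = up_run w"
    using card_greater_hd[OF ys(2,3)] unfolding ys(1,4) by (simp add: y)
  have "avoids_132_213 (x # ys) \<and> signature (x # ys) = s # w"
  proof (cases s)
    case Down
    \<comment> \<open>The run is empty, so \<open>x\<close> is the maximum of
      \<open>S\<close>.\<close>
    then have "{z \<in> S. x < z} = {}" using x Cons.prems by simp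
    then have "z < x" if "z \<in> set ys" for z
      using that unfolding ys(1) by (cases x z rule: linorder_cases) auto
    then show ?thesis
      using avoids_132_213_Cons_greatest[OF ys(3)] Down ys(4) y by force
  next
    case Up
    have "x < y"
    proof (rule ccontr)
      \<comment> \<open>Otherwise everything above \<open>x\<close> lies above \<open>y\<close>, and
        comparing ranks gives \<open>Suc (up_run w) \<le> up_run w\<close>.\<close>
      assume "\<not> x < y"
      then have "{z \<in> S. x < z} \<subseteq> {z \<in> S - {x}. y < z}" using yS by auto
      then have "card {z \<in> S. x < z} \<le> card {z \<in> S - {x}. y < z}"
        using Cons.prems by (intro card_mono) auto
      then show False using x cy Up by simp
    qed
    \<comment> \<open>Inclusion together with equal cardinality shows that no value lies strictly
      between \<open>x\<close> and \<open>y\<close>.\<close>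
    have "insert y {z \<in> S - {x}. y < z} = {z \<in> S. x < z}"
    proof (rule card_subset_eq)
      show "insert y {z \<in> S - {x}. y < z} \<subseteq> {z \<in> S. x < z}"
        using \<open>x < y\<close> yS by auto
      have "card (insert y {z \<in> S - {x}. y < z}) = Suc (up_run w)"
        using cy Cons.prems by (subst card_insert_disjoint) auto
      then show "card (insert y {z \<in> S - {x}. y < z}) = card {z \<in> S. x < z}"
        using x Up by simp
    qed (use Cons.prems in simp)
    moreover have "z \<in> S" "z \<noteq> y" if "z \<in> set ys'" for z
      using that ys(1,2) y by auto
    ultimately have "y < z" if "z \<in> set ys'" "x < z" for z
      using that by blast
    then show ?thesis
      using avoids_132_213_Cons_predecessor[of y ys' x] \<open>x < y\<close> ys y Up by auto
  qed
  then show ?case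
    using S ys by (intro exI[of _ "x # ys"]) auto
qed

section \<open>The bijection with left factors\<close>

lemma bij_betw_signature:
  assumes "n \<ge> 1"
  shows "bij_betw signature (ballot_avoiders n {[1, 3, 2], [2, 1, 3]}) (dyck_left_factors (n - 1))"
proof -
  let ?B = "ballot_avoiders n {[1, 3, 2], [2, 1, 3]}"
  have B: "?B = {xs. set xs = {1..n} \<and> distinct xs \<and> avoids_132_213 xs \<and>
      (\<forall>v. prefix v (signature xs) \<longrightarrow> count_list v Down \<le> count_list v Up)}"
    unfolding ballot_avoiders_def permutations_of_set_def avoids_132_213_iff[symmetric]
    using ballot_iff_signature by auto
  have "inj_on signature ?B"
    unfolding B by (auto intro!: inj_onI signature_inj)
  moreover have "signature ` ?B \<subseteq> dyck_left_factors (n - 1)"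
    unfolding B dyck_left_factors_def
    by (auto simp: length_signature) (metis card_atLeastAtMost diff_Suc_1 distinct_card One_nat_def)
  moreover have "w \<in> signature ` ?B" if w: "w \<in> dyck_left_factors (n - 1)" for w
  proof -
    have "card {1..n} = Suc (length w)"
      using w assms by (simp add: dyck_left_factors_def)
    then show ?thesis
      using signature_surj[of "{1..n}" w] w unfolding B dyck_left_factors_def by auto
  qed
  ultimately show ?thesis
    unfolding bij_betw_def by blast
qed

section \<open>Counting left factors of Dyck paths\<close>

text \<open>Here \<open>k\<close> is the initial distance to the forbidden height -1. The value 0
  thus means that the walk has already failed, and the recursion on the first step needs no special
  case for hitting the barrier.\<close>

definition bounded_words :: "nat \<Rightarrow> nat \<Rightarrow> step list set" where
  "bounded_words m k =
     {w. length w = m \<and> (\<forall>v. prefix v w \<longrightarrow> count_list v Down < count_list v Up + k)}"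

lemma bounded_words_0_left: "bounded_words 0 k = (if k = 0 then {} else {[]})"
  by (auto simp: bounded_words_def)

lemma bounded_words_0_right: "bounded_words m 0 = {}"
  by (auto simp: bounded_words_def intro!: exI[of _ "[]"])

lemma bounded_words_Suc:
  "bounded_words (Suc m) (Suc k) =
     (#) Up ` bounded_words m (Suc (Suc k)) \<union> (#) Down ` bounded_words m k"
proof (rule set_eqI)
  fix w
  show "w \<in> bounded_words (Suc m) (Suc k) \<longleftrightarrow>
      w \<in> (#) Up ` bounded_words m (Suc (Suc k)) \<union> (#) Down ` bounded_words m k"
  proof (cases w)
    case (Cons s u)
    then show ?thesis
      by (cases s) (auto simp: bounded_words_def prefix_Cons image_iff all_conj_distrib imp_conjL)
  qed (auto simp: bounded_words_def)
qed

lemma finite_bounded_words: "finite (bounded_words m k)"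
proof (induction m arbitrary: k)
  case (Suc m)
  then show ?case by (cases k) (auto simp: bounded_words_Suc bounded_words_0_right)
qed (auto simp: bounded_words_0_left)

text \<open>Pascal's rule summed over \<open>D\<close>, with the terms
  \<open>m choose (d - 1)\<close> reindexed; \<open>d = 0\<close> contributes no such term.\<close>

lemma sum_choose_Suc:
  assumes "finite D"
  shows "(\<Sum>d\<in>D. Suc m choose d) = (\<Sum>d\<in>D. m choose d) + (\<Sum>d | Suc d \<in> D. m choose d)"
proof -
  let ?E = "Suc ` {d. Suc d \<in> D}"
  have E: "?E = D - {0}" by (auto simp: image_iff) (metis not0_implies_Suc)
  have "(\<Sum>d | Suc d \<in> D. m choose d) = (\<Sum>d\<in>D - {0}. m choose (d - 1))"
    unfolding E[symmetric] by (simp add: sum.reindex)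
  also have "\<dots> = (\<Sum>d\<in>D. if d = 0 then 0 else m choose (d - 1))"
    using assms by (intro sum.mono_neutral_cong_left) auto
  finally have shifted: "(\<Sum>d | Suc d \<in> D. m choose d) = \<dots>" .
  have "Suc m choose d = (m choose d) + (if d = 0 then 0 else m choose (d - 1))" for d
    by (cases d) auto
  then show ?thesis
    unfolding shifted by (simp only: sum.distrib)
qed

lemma card_bounded_words:
  "card (bounded_words m k) = (\<Sum>d | m \<le> 2 * d + k \<and> 2 * d < m + k. m choose d)"
proof (induction m arbitrary: k)
  case 0
  \<comment> \<open>Only \<open>d = 0\<close> gives a nonzero binomial, and it lies in the range
    exactly when \<open>k > 0\<close>.\<close>
  have "(\<Sum>d | 2 * d < k. 0 choose d) = (\<Sum>d \<in> {d. 2 * d < k} \<inter> {0}. 0 choose d)"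
    by (rule sum.mono_neutral_right) (auto intro: finite_subset[of _ "{..k}"])
  then show ?case by (auto simp: bounded_words_0_left)
next
  case (Suc m)
  show ?case
  proof (cases k)
    case 0
    then show ?thesis by (auto simp: bounded_words_0_right intro!: sum.neutral)
  next
    case (Suc j)
    let ?D = "\<lambda>m k. {d::nat. m \<le> 2 * d + k \<and> 2 * d < m + k}"
    let ?A = "?D (Suc m) (Suc j)" and ?B = "{d. Suc d \<in> ?D (Suc m) (Suc j)}"
    have fin: "finite (?D m k)" for m k
      by (rule finite_subset[of _ "{..m + k}"]) auto
    have finB: "finite ?B"
      by (rule finite_subset[of _ "{..m + j}"]) auto
    have "card (bounded_words (Suc m) k) =
        card (bounded_words m (Suc (Suc j))) + card (bounded_words m j)"
      unfolding Suc bounded_words_Suc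
      by (subst card_Un_disjoint) (auto simp: finite_bounded_words card_image)
    also have "\<dots> = (\<Sum>d\<in>?D m (Suc (Suc j)). m choose d) + (\<Sum>d\<in>?D m j. m choose d)"
      by (simp only: Suc.IH)
    \<comment> \<open>\<open>?B\<close> is the window \<open>?A\<close> shifted down by one. The
      windows after a first \<open>Up\<close> and a first \<open>Down\<close> are their union and
      intersection, so inclusion-exclusion yields the two sums in Pascal's rule.\<close>
    also have "?D m (Suc (Suc j)) = ?A \<union> ?B" by auto
    also have "?D m j = ?A \<inter> ?B" by auto
    also have "(\<Sum>d\<in>?A \<union> ?B. m choose d) + (\<Sum>d\<in>?A \<inter> ?B. m choose d) =
        (\<Sum>d\<in>?A. m choose d) + (\<Sum>d\<in>?B. m choose d)"
      by (rule sum.union_inter[OF fin finB])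
    also have "\<dots> = (\<Sum>d\<in>?A. Suc m choose d)"
      by (rule sum_choose_Suc[OF fin, symmetric])
    finally show ?thesis unfolding Suc .
  qed
qed

text \<open>Starting at height 0 means \<open>k = 1\<close>, and the range of summation then shrinks
  to the single index \<open>m div 2\<close>.\<close>

lemma card_dyck_left_factors: "card (dyck_left_factors m) = m choose (m div 2)"
proof -
  have "dyck_left_factors m = bounded_words m 1"
    by (simp add: dyck_left_factors_def bounded_words_def less_Suc_eq_le)
  moreover have "{d. m \<le> 2 * d + 1 \<and> 2 * d < m + 1} = {m div 2}"
    by auto
  ultimately show ?thesis
    by (simp only: card_bounded_words) simp
qed

theorem theorem3p7:
  shows "(\<forall>n\<ge>1. \<exists>f. bij_betw f (ballot_avoiders n {[1, 3, 2], [2, 1, 3]}) (dyck_left_factors (n - 1)))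
    \<and> (\<forall>n. card (ballot_avoiders (n + 1) {[1, 3, 2], [2, 1, 3]}) = n choose (n div 2))"
proof (intro conjI allI impI)
  fix n :: nat
  assume "n \<ge> 1"
  then show "\<exists>f. bij_betw f (ballot_avoiders n {[1, 3, 2], [2, 1, 3]}) (dyck_left_factors (n - 1))"
    using bij_betw_signature by blast
next
  fix n
  show "card (ballot_avoiders (n + 1) {[1, 3, 2], [2, 1, 3]}) = n choose (n div 2)"
    using bij_betw_same_card[OF bij_betw_signature[of "n + 1"]] card_dyck_left_factors by simp
qed

end
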